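(* Let $H$ be a cocommutative weak Hopf algebra in $\mathcal{C}$, $(A,\varphi_A)$ a weak left $H$-module algebra and $\sigma\in Reg_{\varphi_A}(H^2,A)$. Let $\psi_H^A=(\varphi_A\otimes H)\circ(H\otimes c_{H,A})\circ(\delta_H\otimes A)$ and $\sigma_H^A=(\sigma\otimes\mu_H)\circ\delta_{H^2}$. Then $\sigma$ satisfies the twisted condition $$\mu_A\circ((\varphi_A\circ(H\otimes\varphi_A))\otimes A)\circ(H\otimes H\otimes c_{A,A})\circ(((H\otimes H\otimes\sigma)\circ\delta_{H^2})\otimes A)=\mu_A\circ(A\otimes\varphi_A)\circ(\sigma_H^A\otimes A)$$ if and only if the quadruple $(A,H,\psi_H^A,\sigma_H^A)$ satisfies the twisted condition $$(\mu_A\otimes H)\circ(A\otimes\psi_H^A)\circ(\sigma_H^A\otimes A)=(\mu_A\otimes H)\circ(A\otimes\sigma_H^A)\circ(\psi_H^A\otimes H)\circ(H\otimes\psi_H^A).$$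
   Context: Throughout, $\mathcal{C}$ is a strict symmetric monoidal category with tensor product $\otimes$, unit object $K$, symmetry $c$, and equalizers. For an object $P$ and a morphism $f$, $P\otimes f$ means $id_P\otimes f$ (likewise $f\otimes P$). Algebras $(A,\eta_A,\mu_A)$ are unital associative, coalgebras $(D,\varepsilon_D,\delta_D)$ counital coassociative, all in $\mathcal{C}$; $D$ is cocommutative if $c_{D,D}\circ\delta_D=\delta_D$. For coalgebras $D,E$: $\varepsilon_{D\otimes E}=\varepsilon_D\otimes\varepsilon_E$, $\delta_{D\otimes E}=(D\otimes c_{D,E}\otimes E)\circ(\delta_D\otimes\delta_E)$; $H^2=H\otimes H$ with this coalgebra structure. For morphisms $f,g:B\to A$ from a coalgebra to an algebra, $f\wedge g=\mu_A\circ(f\otimes g)\circ\delta_B$. A weak Hopf algebra $H$ is an algebra and coalgebra in $\mathcal{C}$ with: (a1) $\delta_H\circ\mu_H=(\mu_H\otimes\mu_H)\circ\delta_{H\otimes H}$; (a2) $\varepsilon_H\circ\mu_H\circ(\mu_H\otimes H)=(\varepsilon_H\otimes\varepsilon_H)\circ(\mu_H\otimes\mu_H)\circ(H\otimes\delta_H\otimes H)=(\varepsilon_H\otimes\varepsilon_H)\circ(\mu_H\otimes\mu_H)\circ(H\otimes(c_{H,H}\circ\delta_H)\otimes H)$; (a3) $(\delta_H\otimes H)\circ\delta_H\circ\eta_H=(H\otimes\mu_H\otimes H)\circ(\delta_H\otimes\delta_H)\circ(\eta_H\otimes\eta_H)=(H\otimes(\mu_H\circ c_{H,H})\otimes H)\circ(\delta_H\otimes\delta_H)\circ(\eta_H\otimes\eta_H)$;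 (a4) there is an antipode $\lambda_H:H\to H$ with $id_H\wedge\lambda_H=\Pi_H^L$, $\lambda_H\wedge id_H=\Pi_H^R$, $\lambda_H\wedge id_H\wedge\lambda_H=\lambda_H$, where $\Pi_H^L=((\varepsilon_H\circ\mu_H)\otimes H)\circ(H\otimes c_{H,H})\circ((\delta_H\circ\eta_H)\otimes H)$ and $\Pi_H^R=(H\otimes(\varepsilon_H\circ\mu_H))\circ(c_{H,H}\otimes H)\circ(H\otimes(\delta_H\circ\eta_H))$. A weak left $H$-module algebra is an algebra $A$ with $\varphi_A:H\otimes A\to A$ such that (b1) $\varphi_A\circ(\eta_H\otimes A)=id_A$; (b2) $\varphi_A\circ(H\otimes\mu_A)=\mu_A\circ(\varphi_A\otimes\varphi_A)\circ(H\otimes c_{H,A}\otimes A)\circ(\delta_H\otimes A\otimes A)$; (b3) $\varphi_A\circ(\mu_H\otimes\eta_A)=\varphi_A\circ(H\otimes(\varphi_A\circ(H\otimes\eta_A)))$; (b6) $\varphi_A\circ(\Pi_H^L\otimes\eta_A)=\varphi_A\circ(H\otimes\eta_A)$ (equivalently (b4) $\varphi_A\circ(\Pi_H^L\otimes A)=\mu_A\circ((\varphi_A\circ(H\otimes\eta_A))\otimes A)$). $u_2=\varphi_A\circ(\mu_H\otimes\eta_A)$. $Reg_{\varphi_A}(H^2,A)$ is the set of $\sigma:H^2\to A$ for which there is $\sigma^{-1}:H^2\to A$ with $\sigma\wedge\sigma^{-1}=\sigma^{-1}\wedge\sigma=u_2$, $\sigma\wedge\sigma^{-1}\wedge\sigma=\sigma$,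 $\sigma^{-1}\wedge\sigma\wedge\sigma^{-1}=\sigma^{-1}$. *)

theory Defs
  imports Main
begin

text \<open>
  A category with a tensor product and a symmetry is given by its sets of objects and arrows.
  Composition \<open>g \<cdot> f\<close> (first \<open>f\<close>, then \<open>g\<close>) is only constrained when the codomain of \<open>f\<close> is the
  domain of \<open>g\<close>.  The tensor product is \<open>\<boxtimes>\<close> on objects and \<open>\<otimes>\<close> on arrows; \<open>\<iota> X\<close> is the
  identity of \<open>X\<close>, so that the usual \<open>X \<otimes> f\<close> is written \<open>\<iota> X \<otimes> f\<close>.
\<close>

record ('o, 'm) sm_cat =
  Ob :: "'o set"
  Arr :: "'m set"
  Dom :: "'m \<Rightarrow> 'o"
  Cod :: "'m \<Rightarrow> 'o"
  ident :: "'o \<Rightarrow> 'm" ("\<iota>\<index>")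
  compos :: "'m \<Rightarrow> 'm \<Rightarrow> 'm" (infixr "\<cdot>\<index>" 60)
  tensor_ob :: "'o \<Rightarrow> 'o \<Rightarrow> 'o" (infixr "\<boxtimes>\<index>" 75)
  tensor :: "'m \<Rightarrow> 'm \<Rightarrow> 'm" (infixr "\<otimes>\<index>" 70)
  unit_ob :: "'o" ("\<K>\<index>")
  symm :: "'o \<Rightarrow> 'o \<Rightarrow> 'm" ("\<c>\<index>")

definition hom :: "('o, 'm, 'z) sm_cat_scheme \<Rightarrow> 'o \<Rightarrow> 'o \<Rightarrow> 'm set" where
  "hom C X Y = {f \<in> Arr C. Dom C f = X \<and> Cod C f = Y}"

locale category =
  fixes C :: "('o, 'm, 'z) sm_cat_scheme" (structure)
  assumes Dom_Ob: "f \<in> Arr C \<Longrightarrow> Dom C f \<in> Ob C"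
    and Cod_Ob: "f \<in> Arr C \<Longrightarrow> Cod C f \<in> Ob C"
    and ident_hom: "X \<in> Ob C \<Longrightarrow> \<iota> X \<in> hom C X X"
    and compos_hom: "\<lbrakk>f \<in> hom C X Y; g \<in> hom C Y Z\<rbrakk> \<Longrightarrow> g \<cdot> f \<in> hom C X Z"
    and compos_assoc:
      "\<lbrakk>f \<in> hom C W X; g \<in> hom C X Y; h \<in> hom C Y Z\<rbrakk> \<Longrightarrow> (h \<cdot> g) \<cdot> f = h \<cdot> (g \<cdot> f)"
    and compos_ident_left: "f \<in> hom C X Y \<Longrightarrow> \<iota> Y \<cdot> f = f"
    and compos_ident_right: "f \<in> hom C X Y \<Longrightarrow> f \<cdot> \<iota> X = f"

definition is_equalizer ::
    "('o, 'm, 'z) sm_cat_scheme \<Rightarrow> 'o \<Rightarrow> 'm \<Rightarrow> 'm \<Rightarrow> 'o \<Rightarrow> 'm \<Rightarrow> bool" where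
  "is_equalizer C X f g E e \<longleftrightarrow>
     e \<in> hom C E X \<and> f \<cdot>\<^bsub>C\<^esub> e = g \<cdot>\<^bsub>C\<^esub> e \<and>
     (\<forall>Z h. h \<in> hom C Z X \<and> f \<cdot>\<^bsub>C\<^esub> h = g \<cdot>\<^bsub>C\<^esub> h \<longrightarrow>
        (\<exists>!k. k \<in> hom C Z E \<and> e \<cdot>\<^bsub>C\<^esub> k = h))"

locale category_with_equalizers = category +
  assumes equalizers_exist:
    "\<lbrakk>f \<in> hom C X Y; g \<in> hom C X Y\<rbrakk> \<Longrightarrow> \<exists>E e. is_equalizer C X f g E e"

locale strict_monoidal_category = category +
  assumes unit_Ob: "\<K> \<in> Ob C"
    and tensor_Ob: "\<lbrakk>X \<in> Ob C; Y \<in> Ob C\<rbrakk> \<Longrightarrow> X \<boxtimes> Y \<in> Ob C"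
    and tensor_hom:
      "\<lbrakk>f \<in> hom C X X'; g \<in> hom C Y Y'\<rbrakk> \<Longrightarrow> f \<otimes> g \<in> hom C (X \<boxtimes> Y) (X' \<boxtimes> Y')"
    and tensor_ident: "\<lbrakk>X \<in> Ob C; Y \<in> Ob C\<rbrakk> \<Longrightarrow> \<iota> X \<otimes> \<iota> Y = \<iota> (X \<boxtimes> Y)"
    and tensor_compos:
      "\<lbrakk>f \<in> hom C X X'; f' \<in> hom C X' X''; g \<in> hom C Y Y'; g' \<in> hom C Y' Y''\<rbrakk>
        \<Longrightarrow> (f' \<cdot> f) \<otimes> (g' \<cdot> g) = (f' \<otimes> g') \<cdot> (f \<otimes> g)"
    and tensor_ob_assoc:
      "\<lbrakk>X \<in> Ob C; Y \<in> Ob C; Z \<in> Ob C\<rbrakk> \<Longrightarrow> (X \<boxtimes> Y) \<boxtimes> Z = X \<boxtimes> (Y \<boxtimes> Z)"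
    and tensor_assoc:
      "\<lbrakk>f \<in> Arr C; g \<in> Arr C; h \<in> Arr C\<rbrakk> \<Longrightarrow> (f \<otimes> g) \<otimes> h = f \<otimes> (g \<otimes> h)"
    and unit_tensor_ob: "X \<in> Ob C \<Longrightarrow> \<K> \<boxtimes> X = X"
    and tensor_ob_unit: "X \<in> Ob C \<Longrightarrow> X \<boxtimes> \<K> = X"
    and unit_tensor: "f \<in> Arr C \<Longrightarrow> \<iota> \<K> \<otimes> f = f"
    and tensor_unit: "f \<in> Arr C \<Longrightarrow> f \<otimes> \<iota> \<K> = f"

text \<open>
  In the strict setting a single hexagon suffices, the other one following by involutivity;
  \<open>\<c> X \<K> = \<iota> X\<close> is a consequence as well.
\<close>

locale strict_symmetric_monoidal_category = strict_monoidal_category +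
  assumes symm_hom: "\<lbrakk>X \<in> Ob C; Y \<in> Ob C\<rbrakk> \<Longrightarrow> \<c> X Y \<in> hom C (X \<boxtimes> Y) (Y \<boxtimes> X)"
    and symm_natural:
      "\<lbrakk>f \<in> hom C X X'; g \<in> hom C Y Y'\<rbrakk> \<Longrightarrow> \<c> X' Y' \<cdot> (f \<otimes> g) = (g \<otimes> f) \<cdot> \<c> X Y"
    and symm_involutive: "\<lbrakk>X \<in> Ob C; Y \<in> Ob C\<rbrakk> \<Longrightarrow> \<c> Y X \<cdot> \<c> X Y = \<iota> (X \<boxtimes> Y)"
    and symm_hexagon:
      "\<lbrakk>X \<in> Ob C; Y \<in> Ob C; Z \<in> Ob C\<rbrakk>
        \<Longrightarrow> \<c> X (Y \<boxtimes> Z) = (\<iota> Y \<otimes> \<c> X Z) \<cdot> (\<c> X Y \<otimes> \<iota> Z)"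

locale strict_symmetric_monoidal_category_with_equalizers =
  strict_symmetric_monoidal_category + category_with_equalizers

locale algebra_in = strict_monoidal_category +
  fixes A \<eta> \<mu>
  assumes algebra_Ob: "A \<in> Ob C"
    and unit_hom: "\<eta> \<in> hom C \<K> A"
    and mult_hom: "\<mu> \<in> hom C (A \<boxtimes> A) A"
    and mult_unit_left: "\<mu> \<cdot> (\<eta> \<otimes> \<iota> A) = \<iota> A"
    and mult_unit_right: "\<mu> \<cdot> (\<iota> A \<otimes> \<eta>) = \<iota> A"
    and mult_assoc: "\<mu> \<cdot> (\<mu> \<otimes> \<iota> A) = \<mu> \<cdot> (\<iota> A \<otimes> \<mu>)"

locale coalgebra_in = strict_monoidal_category +
  fixes D \<epsilon> \<delta>
  assumes coalgebra_Ob: "D \<in> Ob C"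
    and counit_hom: "\<epsilon> \<in> hom C D \<K>"
    and comult_hom: "\<delta> \<in> hom C D (D \<boxtimes> D)"
    and counit_left: "(\<epsilon> \<otimes> \<iota> D) \<cdot> \<delta> = \<iota> D"
    and counit_right: "(\<iota> D \<otimes> \<epsilon>) \<cdot> \<delta> = \<iota> D"
    and comult_coassoc: "(\<delta> \<otimes> \<iota> D) \<cdot> \<delta> = (\<iota> D \<otimes> \<delta>) \<cdot> \<delta>"

context
  fixes C :: "('o, 'm, 'z) sm_cat_scheme" (structure)
begin

definition cocommutative :: "'o \<Rightarrow> 'm \<Rightarrow> bool" where
  "cocommutative D \<delta> \<longleftrightarrow> \<c> D D \<cdot> \<delta> = \<delta>"

definition tensor_comult :: "'o \<Rightarrow> 'm \<Rightarrow> 'o \<Rightarrow> 'm \<Rightarrow> 'm" where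
  "tensor_comult D \<delta>D E \<delta>E = (\<iota> D \<otimes> \<c> D E \<otimes> \<iota> E) \<cdot> (\<delta>D \<otimes> \<delta>E)"

text \<open>\<open>convolution \<delta> \<mu> f g\<close> is \<open>f \<and> g\<close> for \<open>\<delta>\<close> the comultiplication of the common domain and
  \<open>\<mu>\<close> the multiplication of the common codomain.  It is associative by (co)associativity of \<open>\<mu>\<close>
  and \<open>\<delta>\<close>; iterated convolutions are bracketed to the left below.\<close>

definition convolution :: "'m \<Rightarrow> 'm \<Rightarrow> 'm \<Rightarrow> 'm \<Rightarrow> 'm" where
  "convolution \<delta> \<mu> f g = \<mu> \<cdot> (f \<otimes> g) \<cdot> \<delta>"

definition Pi_L :: "'o \<Rightarrow> 'm \<Rightarrow> 'm \<Rightarrow> 'm \<Rightarrow> 'm \<Rightarrow> 'm" where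
  "Pi_L H \<eta> \<mu> \<epsilon> \<delta> = ((\<epsilon> \<cdot> \<mu>) \<otimes> \<iota> H) \<cdot> (\<iota> H \<otimes> \<c> H H) \<cdot> ((\<delta> \<cdot> \<eta>) \<otimes> \<iota> H)"

definition Pi_R :: "'o \<Rightarrow> 'm \<Rightarrow> 'm \<Rightarrow> 'm \<Rightarrow> 'm \<Rightarrow> 'm" where
  "Pi_R H \<eta> \<mu> \<epsilon> \<delta> = (\<iota> H \<otimes> (\<epsilon> \<cdot> \<mu>)) \<cdot> (\<c> H H \<otimes> \<iota> H) \<cdot> (\<iota> H \<otimes> (\<delta> \<cdot> \<eta>))"

definition is_antipode :: "'o \<Rightarrow> 'm \<Rightarrow> 'm \<Rightarrow> 'm \<Rightarrow> 'm \<Rightarrow> 'm \<Rightarrow> bool" where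
  "is_antipode H \<eta> \<mu> \<epsilon> \<delta> S \<longleftrightarrow>
     S \<in> hom C H H \<and>
     convolution \<delta> \<mu> (\<iota> H) S = Pi_L H \<eta> \<mu> \<epsilon> \<delta> \<and>
     convolution \<delta> \<mu> S (\<iota> H) = Pi_R H \<eta> \<mu> \<epsilon> \<delta> \<and>
     convolution \<delta> \<mu> (convolution \<delta> \<mu> S (\<iota> H)) S = S"

end

locale weak_hopf_algebra =
  strict_symmetric_monoidal_category C + algebra_in C H \<eta>H \<mu>H + coalgebra_in C H \<epsilon>H \<delta>H
  for C (structure) and H \<eta>H \<mu>H \<epsilon>H \<delta>H +
  assumes comult_mult:
      "\<delta>H \<cdot> \<mu>H = (\<mu>H \<otimes> \<mu>H) \<cdot> tensor_comult C H \<delta>H H \<delta>H"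
    and counit_mult:
      "\<epsilon>H \<cdot> \<mu>H \<cdot> (\<mu>H \<otimes> \<iota> H) = (\<epsilon>H \<otimes> \<epsilon>H) \<cdot> (\<mu>H \<otimes> \<mu>H) \<cdot> (\<iota> H \<otimes> \<delta>H \<otimes> \<iota> H)"
    and counit_mult_symm:
      "\<epsilon>H \<cdot> \<mu>H \<cdot> (\<mu>H \<otimes> \<iota> H) =
        (\<epsilon>H \<otimes> \<epsilon>H) \<cdot> (\<mu>H \<otimes> \<mu>H) \<cdot> (\<iota> H \<otimes> (\<c> H H \<cdot> \<delta>H) \<otimes> \<iota> H)"
    and comult_unit:
      "(\<delta>H \<otimes> \<iota> H) \<cdot> \<delta>H \<cdot> \<eta>H = (\<iota> H \<otimes> \<mu>H \<otimes> \<iota> H) \<cdot> (\<delta>H \<otimes> \<delta>H) \<cdot> (\<eta>H \<otimes> \<eta>H)"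
    and comult_unit_symm:
      "(\<delta>H \<otimes> \<iota> H) \<cdot> \<delta>H \<cdot> \<eta>H =
        (\<iota> H \<otimes> (\<mu>H \<cdot> \<c> H H) \<otimes> \<iota> H) \<cdot> (\<delta>H \<otimes> \<delta>H) \<cdot> (\<eta>H \<otimes> \<eta>H)"
    and antipode_exists: "\<exists>S. is_antipode C H \<eta>H \<mu>H \<epsilon>H \<delta>H S"

locale weak_module_algebra =
  weak_hopf_algebra C H \<eta>H \<mu>H \<epsilon>H \<delta>H + A: algebra_in C A \<eta>A \<mu>A
  for C (structure) and H \<eta>H \<mu>H \<epsilon>H \<delta>H A \<eta>A \<mu>A +
  fixes \<phi>A
  assumes action_hom: "\<phi>A \<in> hom C (H \<boxtimes> A) A"
    and action_unit: "\<phi>A \<cdot> (\<eta>H \<otimes> \<iota> A) = \<iota> A"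
    and action_mult:
      "\<phi>A \<cdot> (\<iota> H \<otimes> \<mu>A) =
        \<mu>A \<cdot> (\<phi>A \<otimes> \<phi>A) \<cdot> (\<iota> H \<otimes> \<c> H A \<otimes> \<iota> A) \<cdot> (\<delta>H \<otimes> \<iota> A \<otimes> \<iota> A)"
    and action_mult_unit: "\<phi>A \<cdot> (\<mu>H \<otimes> \<eta>A) = \<phi>A \<cdot> (\<iota> H \<otimes> (\<phi>A \<cdot> (\<iota> H \<otimes> \<eta>A)))"
    and action_Pi_L: "\<phi>A \<cdot> (Pi_L C H \<eta>H \<mu>H \<epsilon>H \<delta>H \<otimes> \<eta>A) = \<phi>A \<cdot> (\<iota> H \<otimes> \<eta>A)"

context
  fixes C :: "('o, 'm, 'z) sm_cat_scheme" (structure)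
begin

definition u2 :: "'m \<Rightarrow> 'm \<Rightarrow> 'm \<Rightarrow> 'm" where
  "u2 \<mu>H \<eta>A \<phi>A = \<phi>A \<cdot> (\<mu>H \<otimes> \<eta>A)"

definition Reg2 :: "'o \<Rightarrow> 'm \<Rightarrow> 'm \<Rightarrow> 'o \<Rightarrow> 'm \<Rightarrow> 'm \<Rightarrow> 'm \<Rightarrow> 'm set" where
  "Reg2 H \<mu>H \<delta>H A \<eta>A \<mu>A \<phi>A =
     {\<sigma> \<in> hom C (H \<boxtimes> H) A. \<exists>\<sigma>' \<in> hom C (H \<boxtimes> H) A.
        let conv = convolution C (tensor_comult C H \<delta>H H \<delta>H) \<mu>A in
        conv \<sigma> \<sigma>' = u2 \<mu>H \<eta>A \<phi>A \<and> conv \<sigma>' \<sigma> = u2 \<mu>H \<eta>A \<phi>A \<and>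
        conv (conv \<sigma> \<sigma>') \<sigma> = \<sigma> \<and> conv (conv \<sigma>' \<sigma>) \<sigma>' = \<sigma>'}"

definition psi_HA :: "'o \<Rightarrow> 'm \<Rightarrow> 'o \<Rightarrow> 'm \<Rightarrow> 'm" where
  "psi_HA H \<delta>H A \<phi>A = (\<phi>A \<otimes> \<iota> H) \<cdot> (\<iota> H \<otimes> \<c> H A) \<cdot> (\<delta>H \<otimes> \<iota> A)"

definition sigma_HA :: "'o \<Rightarrow> 'm \<Rightarrow> 'm \<Rightarrow> 'm \<Rightarrow> 'm" where
  "sigma_HA H \<mu>H \<delta>H \<sigma> = (\<sigma> \<otimes> \<mu>H) \<cdot> tensor_comult C H \<delta>H H \<delta>H"

definition twisted_morphism :: "'o \<Rightarrow> 'm \<Rightarrow> 'm \<Rightarrow> 'o \<Rightarrow> 'm \<Rightarrow> 'm \<Rightarrow> 'm \<Rightarrow> bool" where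
  "twisted_morphism H \<mu>H \<delta>H A \<mu>A \<phi>A \<sigma> \<longleftrightarrow>
     \<mu>A \<cdot> ((\<phi>A \<cdot> (\<iota> H \<otimes> \<phi>A)) \<otimes> \<iota> A) \<cdot> (\<iota> H \<otimes> \<iota> H \<otimes> \<c> A A) \<cdot>
       (((\<iota> H \<otimes> \<iota> H \<otimes> \<sigma>) \<cdot> tensor_comult C H \<delta>H H \<delta>H) \<otimes> \<iota> A) =
     \<mu>A \<cdot> (\<iota> A \<otimes> \<phi>A) \<cdot> (sigma_HA H \<mu>H \<delta>H \<sigma> \<otimes> \<iota> A)"

text \<open>Here \<open>\<psi> : V \<boxtimes> A \<rightarrow> A \<boxtimes> V\<close> and \<open>\<sigma> : V \<boxtimes> V \<rightarrow> A \<boxtimes> V\<close>.\<close>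

definition twisted_quadruple :: "'o \<Rightarrow> 'm \<Rightarrow> 'o \<Rightarrow> 'm \<Rightarrow> 'm \<Rightarrow> bool" where
  "twisted_quadruple A \<mu>A V \<psi> \<sigma> \<longleftrightarrow>
     (\<mu>A \<otimes> \<iota> V) \<cdot> (\<iota> A \<otimes> \<psi>) \<cdot> (\<sigma> \<otimes> \<iota> A) =
     (\<mu>A \<otimes> \<iota> V) \<cdot> (\<iota> A \<otimes> \<sigma>) \<cdot> (\<psi> \<otimes> \<iota> V) \<cdot> (\<iota> V \<otimes> \<psi>)"

end

end

theory Submission imports Defs begin

text \<open>
  Write \<open>D\<close> for the coalgebra \<open>H \<otimes> H\<close> with comultiplication \<open>\<Delta>\<close>, and, in Sweedler notation,
  let \<open>X (d, a) = \<tau> (d\<^sub>1, a) \<sigma> (d\<^sub>2)\<close> and \<open>Y (d, a) = \<sigma> (d\<^sub>1) \<phi> (\<mu> d\<^sub>2, a)\<close>, where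
  \<open>\<tau> (h, g, a) = h (g a)\<close>, be the two sides of the twisted condition for \<open>\<sigma>\<close>.  The two sides of
  the twisted condition for the quadruple turn out to be \<open>X (d\<^sub>1, a) \<otimes> \<mu> d\<^sub>2\<close> and
  \<open>Y (d\<^sub>1, a) \<otimes> \<mu> d\<^sub>2\<close>, by coassociativity and by multiplicativity of \<open>\<delta>\<close>.  So \<open>X = Y\<close>
  implies the condition for the quadruple.

  For the converse, apply the counit of \<open>H\<close> to the second tensor factor; this gives
  \<open>X (e d, a) = Y (e d, a)\<close> with \<open>e d = d\<^sub>1 \<epsilon> (\<mu> d\<^sub>2)\<close>.  As \<open>\<epsilon> \<circ> \<mu>\<close> need not be the counit of
  \<open>D\<close> when \<open>H\<close> is weak, \<open>e\<close> need not be the identity; but \<open>\<mu> \<circ> e = \<mu>\<close> because \<open>\<mu>\<close> is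
  comultiplicative, and \<open>\<sigma> \<circ> e = \<sigma>\<close> because \<open>\<sigma> = \<sigma> \<and> u\<^sub>2\<close>, where \<open>u\<^sub>2\<close> factors through \<open>\<mu>\<close>.
  As \<open>\<Delta> \<circ> e = (D \<otimes> e) \<circ> \<Delta>\<close>, both \<open>X\<close> and \<open>Y\<close> absorb \<open>e\<close>, whence \<open>X = Y\<close>.

  All maps of the form \<open>(d, a) \<mapsto> Z (d\<^sub>1, a) \<otimes> f (d\<^sub>2)\<close>, among them \<open>\<psi>\<close>, are instances of
  one operation \<open>spread\<close>, and the identification of the two sides is a computation with its laws:
  \<open>spread_tensor_coalgebra\<close>, \<open>spread_compos\<close>, \<open>spread_spread\<close> and \<open>tensor_spread\<close>.
\<close>

section \<open>Arrows with explicit domain and codomain\<close>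

text \<open>
  The laws of the category are restated with typing conditions on \<open>Dom\<close> and \<open>Cod\<close> in place of
  membership in hom-sets, so that the simplifier can discharge them.
\<close>

lemma homD:
  assumes "f \<in> hom C X Y"
  shows "f \<in> Arr C" "Dom C f = X" "Cod C f = Y"
  using assms by (simp_all add: hom_def)

context category
begin

lemma ident_type [simp]:
  assumes "X \<in> Ob C"
  shows "\<iota> X \<in> Arr C" "Dom C (\<iota> X) = X" "Cod C (\<iota> X) = X"
  using ident_hom [OF assms] by (simp_all add: hom_def)

lemma compos_type [simp]:
  assumes "f \<in> Arr C" "g \<in> Arr C" "Dom C g = Cod C f"
  shows "g \<cdot> f \<in> Arr C" "Dom C (g \<cdot> f) = Dom C f" "Cod C (g \<cdot> f) = Cod C g"
  using compos_hom [of f "Dom C f" "Cod C f" g "Cod C g"] assms by (simp_all add: hom_def)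

lemma compos_assoc' [simp]:
  assumes "f \<in> Arr C" "g \<in> Arr C" "h \<in> Arr C" "Dom C g = Cod C f" "Dom C h = Cod C g"
  shows "(h \<cdot> g) \<cdot> f = h \<cdot> g \<cdot> f"
  using compos_assoc [of f "Dom C f" "Cod C f" g "Cod C g" h "Cod C h"] assms
  by (simp add: hom_def)

lemma compos_ident [simp]:
  assumes "f \<in> Arr C"
  shows "Cod C f = Y \<Longrightarrow> \<iota> Y \<cdot> f = f" "Dom C f = X \<Longrightarrow> f \<cdot> \<iota> X = f"
  using compos_ident_left [of f "Dom C f"] compos_ident_right [of f _ "Cod C f"] assms
  by (simp_all add: hom_def)

text \<open>Lifts an equation between composites of two arrows to the inside of a composition chain
  bracketed to the right.\<close>

lemma compos_cong_left:
  assumes "g \<cdot> f = g' \<cdot> f'" and "f \<in> Arr C" "g \<in> Arr C" "Dom C g = Cod C f"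
    and "f' \<in> Arr C" "g' \<in> Arr C" "Dom C g' = Cod C f'"
    and "k \<in> Arr C" "Dom C f = Cod C k" "Dom C f' = Cod C k"
  shows "g \<cdot> f \<cdot> k = g' \<cdot> f' \<cdot> k"
  using assms compos_assoc' [of k f g] compos_assoc' [of k f' g'] by simp

end

context strict_monoidal_category
begin

declare unit_Ob [simp] tensor_Ob [simp] tensor_ob_assoc [simp] unit_tensor_ob [simp]
  tensor_ob_unit [simp] unit_tensor [simp] tensor_unit [simp] tensor_assoc [simp]
  Dom_Ob [simp] Cod_Ob [simp]

lemma tensor_type [simp]:
  assumes "f \<in> Arr C" "g \<in> Arr C"
  shows "f \<otimes> g \<in> Arr C" "Dom C (f \<otimes> g) = Dom C f \<boxtimes> Dom C g"
    "Cod C (f \<otimes> g) = Cod C f \<boxtimes> Cod C g"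
  using tensor_hom [of f "Dom C f" "Cod C f" g "Dom C g" "Cod C g"] assms
  by (simp_all add: hom_def)

lemma interchange:
  assumes "f \<in> Arr C" "f' \<in> Arr C" "g \<in> Arr C" "g' \<in> Arr C"
    and "Dom C f' = Cod C f" "Dom C g' = Cod C g"
  shows "(f' \<otimes> g') \<cdot> (f \<otimes> g) = (f' \<cdot> f) \<otimes> (g' \<cdot> g)"
  using tensor_compos [of f "Dom C f" "Cod C f" f' "Cod C f'" g "Dom C g" "Cod C g" g' "Cod C g'"]
    assms by (simp add: hom_def)

lemma interchange_compos:
  assumes "f \<in> Arr C" "f' \<in> Arr C" "g \<in> Arr C" "g' \<in> Arr C" "k \<in> Arr C"
    and "Dom C f' = Cod C f" "Dom C g' = Cod C g" "Cod C k = Dom C f \<boxtimes> Dom C g"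
  shows "(f' \<otimes> g') \<cdot> (f \<otimes> g) \<cdot> k = ((f' \<cdot> f) \<otimes> (g' \<cdot> g)) \<cdot> k"
  using assms compos_assoc' [of k "f \<otimes> g" "f' \<otimes> g'"] by (simp add: interchange)

end

section \<open>The symmetry\<close>

context strict_symmetric_monoidal_category
begin

lemma symm_type [simp]:
  assumes "X \<in> Ob C" "Y \<in> Ob C"
  shows "\<c> X Y \<in> Arr C" "Dom C (\<c> X Y) = X \<boxtimes> Y" "Cod C (\<c> X Y) = Y \<boxtimes> X"
  using symm_hom [OF assms] by (simp_all add: hom_def)

lemma symm_nat:
  assumes "f \<in> Arr C" "g \<in> Arr C" "Cod C f = X" "Cod C g = Y"
  shows "\<c> X Y \<cdot> (f \<otimes> g) = (g \<otimes> f) \<cdot> \<c> (Dom C f) (Dom C g)"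
  using symm_natural [of f "Dom C f" X g "Dom C g" Y] assms by (simp add: hom_def)

text \<open>The other hexagon, obtained by inverting the given one.\<close>

lemma symm_tensor_left:
  assumes [simp]: "X \<in> Ob C" "Y \<in> Ob C" "Z \<in> Ob C"
  shows "\<c> (X \<boxtimes> Y) Z = (\<c> X Z \<otimes> \<iota> Y) \<cdot> (\<iota> X \<otimes> \<c> Y Z)"
proof -
  let ?l = "\<c> (X \<boxtimes> Y) Z" and ?r = "(\<c> X Z \<otimes> \<iota> Y) \<cdot> (\<iota> X \<otimes> \<c> Y Z)"
  have inv: "\<c> Z (X \<boxtimes> Y) \<cdot> ?r = \<iota> (X \<boxtimes> Y \<boxtimes> Z)"
    by (simp add: symm_hexagon interchange interchange_compos symm_involutive tensor_ident)
  have "?l = ?l \<cdot> \<c> Z (X \<boxtimes> Y) \<cdot> ?r"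
    by (simp add: inv)
  also have "\<dots> = (?l \<cdot> \<c> Z (X \<boxtimes> Y)) \<cdot> ?r"
    by simp
  also have "\<dots> = ?r"
    by (simp add: symm_involutive)
  finally show ?thesis .
qed

lemma symm_unit:
  assumes [simp]: "X \<in> Ob C"
  shows "\<c> X \<K> = \<iota> X" "\<c> \<K> X = \<iota> X"
proof -
  \<comment> \<open>The hexagon makes \<open>\<c> X \<K>\<close> idempotent, and it is invertible.\<close>
  have idem: "\<c> X \<K> = \<c> X \<K> \<cdot> \<c> X \<K>"
    using symm_hexagon [of X \<K> \<K>] by simp
  have inv: "\<c> \<K> X \<cdot> \<c> X \<K> = \<iota> X"
    using symm_involutive [of X \<K>] by simp
  have "\<iota> X = \<c> \<K> X \<cdot> \<c> X \<K> \<cdot> \<c> X \<K>"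
    using inv idem by simp
  also have "\<dots> = (\<c> \<K> X \<cdot> \<c> X \<K>) \<cdot> \<c> X \<K>"
    by simp
  also have "\<dots> = \<c> X \<K>"
    by (simp add: inv)
  finally show 1: "\<c> X \<K> = \<iota> X" by simp
  show "\<c> \<K> X = \<iota> X"
    using inv by (simp add: 1)
qed

section \<open>Spreading a morphism over a comultiplication\<close>

text \<open>
  For \<open>Z : D \<boxtimes> A \<rightarrow> B\<close> and \<open>f : D \<rightarrow> E\<close>, \<open>spread D \<delta> A Z f : D \<boxtimes> A \<rightarrow> B \<boxtimes> E\<close> is the
  morphism \<open>(d, a) \<mapsto> Z (d\<^sub>1, a) \<otimes> f (d\<^sub>2)\<close>.  The objects \<open>D\<close> and \<open>A\<close> are arguments because
  they are needed for the symmetry and cannot be recovered separately from \<open>Dom C Z\<close>.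
\<close>

definition spread :: "'a \<Rightarrow> 'b \<Rightarrow> 'a \<Rightarrow> 'b \<Rightarrow> 'b \<Rightarrow> 'b" where
  "spread D \<delta> A Z f = (Z \<otimes> f) \<cdot> (\<iota> D \<otimes> \<c> D A) \<cdot> (\<delta> \<otimes> \<iota> A)"

section \<open>The tensor product of two coalgebras\<close>

lemma tensor_coalgebra:
  assumes "coalgebra_in C D \<epsilon> \<delta>" "coalgebra_in C E \<epsilon>' \<delta>'"
  shows "coalgebra_in C (D \<boxtimes> E) (\<epsilon> \<otimes> \<epsilon>') (tensor_comult C D \<delta> E \<delta>')"
proof -
  interpret D: coalgebra_in C D \<epsilon> \<delta> by fact
  interpret E: coalgebra_in C E \<epsilon>' \<delta>' by fact
  note [simp] = D.coalgebra_Ob E.coalgebra_Ob homD [OF D.counit_hom] homD [OF E.counit_hom]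
    homD [OF D.comult_hom] homD [OF E.comult_hom]
  have [simp]: "(\<iota> D \<otimes> \<iota> D) \<cdot> \<delta> = \<delta>" "(\<iota> E \<otimes> \<iota> E) \<cdot> \<delta>' = \<delta>'"
    by (simp_all add: tensor_ident)
  let ?\<delta> = "tensor_comult C D \<delta> E \<delta>'"
  have type: "?\<delta> \<in> hom C (D \<boxtimes> E) ((D \<boxtimes> E) \<boxtimes> (D \<boxtimes> E))"
    by (simp add: tensor_comult_def hom_def)
  have left: "((\<epsilon> \<otimes> \<epsilon>') \<otimes> \<iota> (D \<boxtimes> E)) \<cdot> ?\<delta> = \<iota> (D \<boxtimes> E)"
  proof -
    have "(\<epsilon>' \<otimes> \<iota> D) \<cdot> \<c> D E = \<iota> D \<otimes> \<epsilon>'"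
      using symm_nat [of "\<iota> D" \<epsilon>' D \<K>] by (simp add: symm_unit)
    then have "((\<epsilon> \<otimes> \<epsilon>') \<otimes> \<iota> (D \<boxtimes> E)) \<cdot> (\<iota> D \<otimes> \<c> D E \<otimes> \<iota> E) =
        (\<epsilon> \<otimes> \<iota> D) \<otimes> (\<epsilon>' \<otimes> \<iota> E)"
      using interchange [of "\<iota> D" \<epsilon> "\<c> D E \<otimes> \<iota> E" "(\<epsilon>' \<otimes> \<iota> D) \<otimes> \<iota> E"]
        interchange [of "\<c> D E" "\<epsilon>' \<otimes> \<iota> D" "\<iota> E" "\<iota> E"]
      by (simp add: tensor_ident [symmetric])
    then show ?thesis
      using compos_assoc' [of "\<delta> \<otimes> \<delta>'" "\<iota> D \<otimes> \<c> D E \<otimes> \<iota> E" "(\<epsilon> \<otimes> \<epsilon>') \<otimes> \<iota> (D \<boxtimes> E)"]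
        interchange [of \<delta> "\<epsilon> \<otimes> \<iota> D" \<delta>' "\<epsilon>' \<otimes> \<iota> E"]
      by (simp add: tensor_comult_def D.counit_left E.counit_left tensor_ident)
  qed
  have right: "(\<iota> (D \<boxtimes> E) \<otimes> (\<epsilon> \<otimes> \<epsilon>')) \<cdot> ?\<delta> = \<iota> (D \<boxtimes> E)"
  proof -
    have "(\<iota> E \<otimes> \<epsilon>) \<cdot> \<c> D E = \<epsilon> \<otimes> \<iota> E"
      using symm_nat [of \<epsilon> "\<iota> E" \<K> E] by (simp add: symm_unit)
    then have "(\<iota> (D \<boxtimes> E) \<otimes> (\<epsilon> \<otimes> \<epsilon>')) \<cdot> (\<iota> D \<otimes> \<c> D E \<otimes> \<iota> E) =
        (\<iota> D \<otimes> \<epsilon>) \<otimes> (\<iota> E \<otimes> \<epsilon>')"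
      using interchange [of "\<iota> D" "\<iota> D" "\<c> D E \<otimes> \<iota> E" "(\<iota> E \<otimes> \<epsilon>) \<otimes> \<epsilon>'"]
        interchange [of "\<c> D E" "\<iota> E \<otimes> \<epsilon>" "\<iota> E" \<epsilon>']
      by (simp add: tensor_ident [symmetric])
    then show ?thesis
      using compos_assoc' [of "\<delta> \<otimes> \<delta>'" "\<iota> D \<otimes> \<c> D E \<otimes> \<iota> E" "\<iota> (D \<boxtimes> E) \<otimes> (\<epsilon> \<otimes> \<epsilon>')"]
        interchange [of \<delta> "\<iota> D \<otimes> \<epsilon>" \<delta>' "\<iota> E \<otimes> \<epsilon>'"]
      by (simp add: tensor_comult_def D.counit_right E.counit_right tensor_ident)
  qed
  have coassoc: "(?\<delta> \<otimes> \<iota> (D \<boxtimes> E)) \<cdot> ?\<delta> = (\<iota> (D \<boxtimes> E) \<otimes> ?\<delta>) \<cdot> ?\<delta>"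
  proof -
    \<comment> \<open>Naturality moves all comultiplications to the right and all symmetries to the left; the
      two iterated comultiplications then differ by \<open>perm\<close> and by coassociativity of the factors.\<close>
    have l: "(\<delta> \<otimes> \<delta>' \<otimes> \<iota> (D \<boxtimes> E)) \<cdot> (\<iota> D \<otimes> \<c> D E \<otimes> \<iota> E) =
        (\<iota> (D \<boxtimes> D) \<otimes> \<c> D (E \<boxtimes> E) \<otimes> \<iota> E) \<cdot> (\<delta> \<otimes> \<iota> D \<otimes> \<delta>' \<otimes> \<iota> E)"
      using symm_nat [of "\<iota> D" \<delta>' D "E \<boxtimes> E"]
        interchange [of "\<iota> D" \<delta> "\<c> D E \<otimes> \<iota> E" "(\<delta>' \<otimes> \<iota> D) \<otimes> \<iota> E"]
        interchange [of "\<c> D E" "\<delta>' \<otimes> \<iota> D" "\<iota> E" "\<iota> E"]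
        interchange [of \<delta> "\<iota> (D \<boxtimes> D)" "(\<iota> D \<otimes> \<delta>') \<otimes> \<iota> E" "\<c> D (E \<boxtimes> E) \<otimes> \<iota> E"]
        interchange [of "\<iota> D \<otimes> \<delta>'" "\<c> D (E \<boxtimes> E)" "\<iota> E" "\<iota> E"]
      by (simp add: tensor_ident [symmetric])
    have r: "(\<iota> (D \<boxtimes> E) \<otimes> \<delta> \<otimes> \<delta>') \<cdot> (\<iota> D \<otimes> \<c> D E \<otimes> \<iota> E) =
        (\<iota> D \<otimes> \<c> (D \<boxtimes> D) E \<otimes> \<iota> (E \<boxtimes> E)) \<cdot> (\<iota> D \<otimes> \<delta> \<otimes> \<iota> E \<otimes> \<delta>')"
      using symm_nat [of \<delta> "\<iota> E" "D \<boxtimes> D" E]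
        interchange [of "\<iota> D" "\<iota> D" "\<c> D E \<otimes> \<iota> E" "(\<iota> E \<otimes> \<delta>) \<otimes> \<delta>'"]
        interchange [of "\<c> D E" "\<iota> E \<otimes> \<delta>" "\<iota> E" "\<delta>'"]
        interchange [of "\<iota> D" "\<iota> D" "(\<delta> \<otimes> \<iota> E) \<otimes> \<delta>'" "\<c> (D \<boxtimes> D) E \<otimes> \<iota> (E \<boxtimes> E)"]
        interchange [of "\<delta> \<otimes> \<iota> E" "\<c> (D \<boxtimes> D) E" \<delta>' "\<iota> (E \<boxtimes> E)"]
      by (simp add: tensor_ident [symmetric])
    have perm: "(\<iota> D \<otimes> \<c> D E \<otimes> \<iota> (E \<boxtimes> D \<boxtimes> E)) \<cdot> (\<iota> (D \<boxtimes> D) \<otimes> \<c> D (E \<boxtimes> E) \<otimes> \<iota> E) =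
       (\<iota> (D \<boxtimes> E \<boxtimes> D) \<otimes> \<c> D E \<otimes> \<iota> E) \<cdot> (\<iota> D \<otimes> \<c> (D \<boxtimes> D) E \<otimes> \<iota> (E \<boxtimes> E))"
    proof -
      have "(\<c> D E \<otimes> \<iota> (E \<boxtimes> D \<boxtimes> E)) \<cdot> (\<iota> (D \<boxtimes> E) \<otimes> \<c> D E \<otimes> \<iota> E) =
          (\<iota> (E \<boxtimes> D) \<otimes> \<c> D E \<otimes> \<iota> E) \<cdot> (\<c> D E \<otimes> \<iota> (D \<boxtimes> E \<boxtimes> E))"
        by (simp add: interchange)
      then have q: "(\<iota> D \<otimes> \<c> D E \<otimes> \<iota> (E \<boxtimes> D \<boxtimes> E)) \<cdot> (\<iota> D \<otimes> \<iota> (D \<boxtimes> E) \<otimes> \<c> D E \<otimes> \<iota> E) =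
          (\<iota> D \<otimes> \<iota> (E \<boxtimes> D) \<otimes> \<c> D E \<otimes> \<iota> E) \<cdot> (\<iota> D \<otimes> \<c> D E \<otimes> \<iota> (D \<boxtimes> E \<boxtimes> E))"
        by (simp add: interchange)
      have [simp]: "(\<iota> D \<otimes> \<iota> D) \<cdot> (\<iota> D \<otimes> \<iota> D) = \<iota> D \<otimes> \<iota> D"
        "(\<iota> E \<otimes> \<iota> E) \<cdot> (\<iota> E \<otimes> \<iota> E) = \<iota> E \<otimes> \<iota> E"
        by (simp_all add: tensor_ident)
      have a: "\<iota> (D \<boxtimes> D) \<otimes> \<c> D (E \<boxtimes> E) \<otimes> \<iota> E =
          (\<iota> D \<otimes> \<iota> (D \<boxtimes> E) \<otimes> \<c> D E \<otimes> \<iota> E) \<cdot> (\<iota> (D \<boxtimes> D) \<otimes> \<c> D E \<otimes> \<iota> (E \<boxtimes> E))"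
        using interchange [of "\<c> D E \<otimes> \<iota> E" "\<iota> E \<otimes> \<c> D E" "\<iota> E" "\<iota> E"]
          interchange [of "\<iota> (D \<boxtimes> D)" "\<iota> (D \<boxtimes> D)" "\<c> D E \<otimes> \<iota> E \<otimes> \<iota> E" "\<iota> E \<otimes> \<c> D E \<otimes> \<iota> E"]
        by (simp add: symm_hexagon tensor_ident [symmetric])
      have b: "\<iota> D \<otimes> \<c> (D \<boxtimes> D) E \<otimes> \<iota> (E \<boxtimes> E) =
          (\<iota> D \<otimes> \<c> D E \<otimes> \<iota> (D \<boxtimes> E \<boxtimes> E)) \<cdot> (\<iota> (D \<boxtimes> D) \<otimes> \<c> D E \<otimes> \<iota> (E \<boxtimes> E))"
        using interchange [of "\<iota> D \<otimes> \<c> D E" "\<c> D E \<otimes> \<iota> D" "\<iota> (E \<boxtimes> E)" "\<iota> (E \<boxtimes> E)"]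
          interchange [of "\<iota> D" "\<iota> D" "\<iota> D \<otimes> \<c> D E \<otimes> \<iota> (E \<boxtimes> E)" "\<c> D E \<otimes> \<iota> D \<otimes> \<iota> (E \<boxtimes> E)"]
        by (simp add: symm_tensor_left tensor_ident [symmetric])
      show ?thesis
        unfolding a b
        using compos_cong_left [OF q, of "\<iota> (D \<boxtimes> D) \<otimes> \<c> D E \<otimes> \<iota> (E \<boxtimes> E)"]
        by (simp add: tensor_ident [symmetric])
    qed
    have a: "(\<delta> \<otimes> \<iota> D \<otimes> \<delta>' \<otimes> \<iota> E) \<cdot> (\<delta> \<otimes> \<delta>') = (\<iota> D \<otimes> \<delta> \<otimes> \<iota> E \<otimes> \<delta>') \<cdot> (\<delta> \<otimes> \<delta>')"
      using interchange [of \<delta> "\<delta> \<otimes> \<iota> D" \<delta>' "\<delta>' \<otimes> \<iota> E"]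
        interchange [of \<delta> "\<iota> D \<otimes> \<delta>" \<delta>' "\<iota> E \<otimes> \<delta>'"]
      by (simp add: D.comult_coassoc E.comult_coassoc)
    have "?\<delta> \<otimes> \<iota> (D \<boxtimes> E) = (\<iota> D \<otimes> \<c> D E \<otimes> \<iota> (E \<boxtimes> D \<boxtimes> E)) \<cdot> (\<delta> \<otimes> \<delta>' \<otimes> \<iota> (D \<boxtimes> E))"
      using interchange [of "\<delta> \<otimes> \<delta>'" "\<iota> D \<otimes> \<c> D E \<otimes> \<iota> E" "\<iota> (D \<boxtimes> E)" "\<iota> (D \<boxtimes> E)"]
      by (simp add: tensor_comult_def tensor_ident)
    then have "(?\<delta> \<otimes> \<iota> (D \<boxtimes> E)) \<cdot> ?\<delta> = (\<iota> D \<otimes> \<c> D E \<otimes> \<iota> (E \<boxtimes> D \<boxtimes> E)) \<cdot>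
        (\<delta> \<otimes> \<delta>' \<otimes> \<iota> (D \<boxtimes> E)) \<cdot> (\<iota> D \<otimes> \<c> D E \<otimes> \<iota> E) \<cdot> (\<delta> \<otimes> \<delta>')"
      by (simp add: tensor_comult_def)
    also have "\<dots> = (\<iota> D \<otimes> \<c> D E \<otimes> \<iota> (E \<boxtimes> D \<boxtimes> E)) \<cdot>
        (\<iota> (D \<boxtimes> D) \<otimes> \<c> D (E \<boxtimes> E) \<otimes> \<iota> E) \<cdot> (\<iota> D \<otimes> \<delta> \<otimes> \<iota> E \<otimes> \<delta>') \<cdot> (\<delta> \<otimes> \<delta>')"
      by (simp add: compos_cong_left [OF l] a)
    also have "\<dots> = (\<iota> (D \<boxtimes> E \<boxtimes> D) \<otimes> \<c> D E \<otimes> \<iota> E) \<cdot>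
        (\<iota> (D \<boxtimes> E) \<otimes> \<delta> \<otimes> \<delta>') \<cdot> (\<iota> D \<otimes> \<c> D E \<otimes> \<iota> E) \<cdot> (\<delta> \<otimes> \<delta>')"
      by (simp add: compos_cong_left [OF perm] compos_cong_left [OF r])
    also have "\<dots> = (\<iota> (D \<boxtimes> E) \<otimes> ?\<delta>) \<cdot> ?\<delta>"
    proof -
      have "\<iota> (D \<boxtimes> E) \<otimes> ?\<delta> = (\<iota> (D \<boxtimes> E) \<otimes> \<iota> D \<otimes> \<c> D E \<otimes> \<iota> E) \<cdot> (\<iota> (D \<boxtimes> E) \<otimes> \<delta> \<otimes> \<delta>')"
        using interchange [of "\<iota> (D \<boxtimes> E)" "\<iota> (D \<boxtimes> E)" "\<delta> \<otimes> \<delta>'" "\<iota> D \<otimes> \<c> D E \<otimes> \<iota> E"]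
        by (simp add: tensor_comult_def)
      then show ?thesis
        by (simp add: tensor_comult_def tensor_ident [symmetric])
    qed
    finally show ?thesis .
  qed
  show ?thesis
    by unfold_locales (use type left right coassoc in \<open>simp_all add: hom_def\<close>)
qed

end

section \<open>Laws of spreading over one coalgebra\<close>

text \<open>A coalgebra in a symmetric monoidal category.\<close>

locale symmetric_coalgebra = strict_symmetric_monoidal_category C + coalgebra_in C D \<epsilon> \<delta>
  for C (structure) and D \<epsilon> \<delta>
begin

lemmas coalgebra_type [simp] = coalgebra_Ob homD [OF counit_hom] homD [OF comult_hom]

lemma spread_type [simp]:
  assumes "A \<in> Ob C" "Z \<in> Arr C" "Dom C Z = D \<boxtimes> A" "f \<in> Arr C" "Dom C f = D"
  shows "spread D \<delta> A Z f \<in> Arr C" "Dom C (spread D \<delta> A Z f) = D \<boxtimes> A"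
    "Cod C (spread D \<delta> A Z f) = Cod C Z \<boxtimes> Cod C f"
  using assms by (simp_all add: spread_def)

lemma compos_spread:
  assumes "A \<in> Ob C" "Z \<in> Arr C" "Dom C Z = D \<boxtimes> A" "f \<in> Arr C" "Dom C f = D"
    "k \<in> Arr C" "Dom C k = Cod C Z" "l \<in> Arr C" "Dom C l = Cod C f"
  shows "(k \<otimes> l) \<cdot> spread D \<delta> A Z f = spread D \<delta> A (k \<cdot> Z) (l \<cdot> f)"
  using assms by (simp add: spread_def interchange_compos)

text \<open>Coassociativity in the form used by the next two lemmas: the two ways of mapping \<open>d \<otimes> a\<close> to
  \<open>d\<^sub>1 \<otimes> d\<^sub>2 \<otimes> a \<otimes> d\<^sub>3\<close> agree.\<close>

lemma comult_slide:
  assumes [simp]: "A \<in> Ob C"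
  shows "(\<delta> \<otimes> \<iota> A \<otimes> \<iota> D) \<cdot> (\<iota> D \<otimes> \<c> D A) \<cdot> (\<delta> \<otimes> \<iota> A) =
    (\<iota> D \<otimes> \<iota> D \<otimes> \<c> D A) \<cdot> (\<iota> D \<otimes> \<delta> \<otimes> \<iota> A) \<cdot> (\<delta> \<otimes> \<iota> A)"
proof -
  have "(\<delta> \<otimes> \<iota> (A \<boxtimes> D)) \<cdot> (\<iota> D \<otimes> \<c> D A) = (\<iota> (D \<boxtimes> D) \<otimes> \<c> D A) \<cdot> (\<delta> \<otimes> \<iota> (D \<boxtimes> A))"
    by (simp add: interchange)
  then have s: "(\<delta> \<otimes> \<iota> A \<otimes> \<iota> D) \<cdot> (\<iota> D \<otimes> \<c> D A) =
      (\<iota> D \<otimes> \<iota> D \<otimes> \<c> D A) \<cdot> (\<delta> \<otimes> \<iota> D \<otimes> \<iota> A)"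
    by (simp add: tensor_ident [symmetric])
  have a: "(\<delta> \<otimes> \<iota> D \<otimes> \<iota> A) \<cdot> (\<delta> \<otimes> \<iota> A) = (\<iota> D \<otimes> \<delta> \<otimes> \<iota> A) \<cdot> (\<delta> \<otimes> \<iota> A)"
    using interchange [of \<delta> "\<delta> \<otimes> \<iota> D" "\<iota> A" "\<iota> A"] interchange [of \<delta> "\<iota> D \<otimes> \<delta>" "\<iota> A" "\<iota> A"]
    by (simp add: comult_coassoc)
  show ?thesis
    by (simp add: compos_cong_left [OF s] a)
qed

lemma spread_spread:
  assumes [simp]: "A \<in> Ob C" "Z \<in> Arr C" "Dom C Z = D \<boxtimes> A" "f \<in> Arr C" "Dom C f = D"
    "g \<in> Arr C" "Dom C g = D"
  shows "spread D \<delta> A (spread D \<delta> A Z f) g = spread D \<delta> A Z ((f \<otimes> g) \<cdot> \<delta>)"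
proof -
  let ?P = "(\<iota> D \<otimes> \<c> D A) \<cdot> (\<delta> \<otimes> \<iota> A)"
  have P: "?P \<otimes> \<iota> D = (\<iota> D \<otimes> \<c> D A \<otimes> \<iota> D) \<cdot> (\<delta> \<otimes> \<iota> A \<otimes> \<iota> D)"
    using interchange [of "\<delta> \<otimes> \<iota> A" "\<iota> D \<otimes> \<c> D A" "\<iota> D" "\<iota> D"] by simp
  have "spread D \<delta> A (spread D \<delta> A Z f) g = (Z \<otimes> f \<otimes> g) \<cdot> (?P \<otimes> \<iota> D) \<cdot> ?P"
    using interchange_compos [of ?P "Z \<otimes> f" "\<iota> D" g ?P] by (simp add: spread_def)
  also have "\<dots> = (Z \<otimes> f \<otimes> g) \<cdot> (\<iota> D \<otimes> \<c> D A \<otimes> \<iota> D) \<cdot>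
      (\<delta> \<otimes> \<iota> A \<otimes> \<iota> D) \<cdot> (\<iota> D \<otimes> \<c> D A) \<cdot> (\<delta> \<otimes> \<iota> A)"
    by (simp add: P)
  also have "\<dots> = (Z \<otimes> f \<otimes> g) \<cdot> (\<iota> D \<otimes> \<c> D A \<otimes> \<iota> D) \<cdot>
      (\<iota> D \<otimes> \<iota> D \<otimes> \<c> D A) \<cdot> (\<iota> D \<otimes> \<delta> \<otimes> \<iota> A) \<cdot> (\<delta> \<otimes> \<iota> A)"
    by (simp add: comult_slide)
  also have "\<dots> = (Z \<otimes> f \<otimes> g) \<cdot> (\<iota> D \<otimes> (\<c> (D \<boxtimes> D) A \<cdot> (\<delta> \<otimes> \<iota> A))) \<cdot> (\<delta> \<otimes> \<iota> A)"
    by (simp add: symm_tensor_left interchange_compos)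
  also have "\<c> (D \<boxtimes> D) A \<cdot> (\<delta> \<otimes> \<iota> A) = (\<iota> A \<otimes> \<delta>) \<cdot> \<c> D A"
    using symm_nat [of \<delta> "\<iota> A" "D \<boxtimes> D" A] by simp
  also have "\<iota> D \<otimes> ((\<iota> A \<otimes> \<delta>) \<cdot> \<c> D A) = (\<iota> (D \<boxtimes> A) \<otimes> \<delta>) \<cdot> (\<iota> D \<otimes> \<c> D A)"
    using interchange [of "\<iota> D" "\<iota> D" "\<c> D A" "\<iota> A \<otimes> \<delta>"] by (simp add: tensor_ident [symmetric])
  also have "(Z \<otimes> f \<otimes> g) \<cdot> ((\<iota> (D \<boxtimes> A) \<otimes> \<delta>) \<cdot> (\<iota> D \<otimes> \<c> D A)) \<cdot> (\<delta> \<otimes> \<iota> A) =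
      spread D \<delta> A Z ((f \<otimes> g) \<cdot> \<delta>)"
    by (simp add: spread_def interchange_compos)
  finally show ?thesis .
qed

lemma tensor_spread:
  assumes [simp]: "A \<in> Ob C" "Z \<in> Arr C" "Dom C Z = D \<boxtimes> A" "f \<in> Arr C" "Dom C f = D"
    "s \<in> Arr C" "Dom C s = D"
  shows "(s \<otimes> spread D \<delta> A Z f) \<cdot> (\<delta> \<otimes> \<iota> A) = spread D \<delta> A ((s \<otimes> Z) \<cdot> (\<delta> \<otimes> \<iota> A)) f"
proof -
  have "(s \<otimes> spread D \<delta> A Z f) \<cdot> (\<delta> \<otimes> \<iota> A) = (s \<otimes> Z \<otimes> f) \<cdot>
      (\<iota> D \<otimes> \<iota> D \<otimes> \<c> D A) \<cdot> (\<iota> D \<otimes> \<delta> \<otimes> \<iota> A) \<cdot> (\<delta> \<otimes> \<iota> A)"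
    by (simp add: spread_def interchange_compos)
  also have "\<dots> = (s \<otimes> Z \<otimes> f) \<cdot> (\<delta> \<otimes> \<iota> A \<otimes> \<iota> D) \<cdot> (\<iota> D \<otimes> \<c> D A) \<cdot> (\<delta> \<otimes> \<iota> A)"
    by (simp add: comult_slide)
  also have "\<dots> = spread D \<delta> A ((s \<otimes> Z) \<cdot> (\<delta> \<otimes> \<iota> A)) f"
    using interchange_compos [of "\<delta> \<otimes> \<iota> A" "s \<otimes> Z" "\<iota> D" f "(\<iota> D \<otimes> \<c> D A) \<cdot> (\<delta> \<otimes> \<iota> A)"]
    by (simp add: spread_def)
  finally show ?thesis .
qed

text \<open>If \<open>f\<close> takes values in the unit object, spreading amounts to precomposing \<open>Z\<close> with
  \<open>d \<mapsto> d\<^sub>1 f (d\<^sub>2)\<close> on the first factor.\<close>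

lemma spread_counit:
  assumes [simp]: "A \<in> Ob C" "Z \<in> Arr C" "Dom C Z = D \<boxtimes> A"
    "f \<in> Arr C" "Dom C f = D" "Cod C f = \<K>"
  shows "spread D \<delta> A Z f = Z \<cdot> (((\<iota> D \<otimes> f) \<cdot> \<delta>) \<otimes> \<iota> A)"
proof -
  have "(\<iota> A \<otimes> f) \<cdot> \<c> D A = f \<otimes> \<iota> A"
    using symm_nat [of f "\<iota> A" \<K> A] by (simp add: symm_unit)
  then have s: "(\<iota> (D \<boxtimes> A) \<otimes> f) \<cdot> (\<iota> D \<otimes> \<c> D A) = \<iota> D \<otimes> f \<otimes> \<iota> A"
    using interchange [of "\<iota> D" "\<iota> D" "\<c> D A" "\<iota> A \<otimes> f"] by (simp add: tensor_ident [symmetric])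
  have "spread D \<delta> A Z f = Z \<cdot> (\<iota> (D \<boxtimes> A) \<otimes> f) \<cdot> (\<iota> D \<otimes> \<c> D A) \<cdot> (\<delta> \<otimes> \<iota> A)"
    using interchange_compos [of "\<iota> (D \<boxtimes> A)" Z f "\<iota> \<K>" "(\<iota> D \<otimes> \<c> D A) \<cdot> (\<delta> \<otimes> \<iota> A)"]
    by (simp add: spread_def)
  also have "\<dots> = Z \<cdot> (\<iota> D \<otimes> f \<otimes> \<iota> A) \<cdot> (\<delta> \<otimes> \<iota> A)"
    using compos_assoc' [of "\<delta> \<otimes> \<iota> A" "\<iota> D \<otimes> \<c> D A" "\<iota> (D \<boxtimes> A) \<otimes> f"] by (simp add: s)
  finally show ?thesis
    using interchange [of \<delta> "\<iota> D \<otimes> f" "\<iota> A" "\<iota> A"] by simp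
qed

section \<open>Convolution\<close>

text \<open>The endomorphism \<open>e = (\<iota> D \<otimes> f) \<cdot> \<delta>\<close>, that is \<open>d \<mapsto> d\<^sub>1 f (d\<^sub>2)\<close>, satisfies
  \<open>\<delta> \<cdot> e = (\<iota> D \<otimes> e) \<cdot> \<delta>\<close>; so a convolution absorbs \<open>e\<close> as soon as its right factor does.\<close>

lemma comult_absorb:
  assumes [simp]: "f \<in> Arr C" "Dom C f = D" "Cod C f = \<K>"
  shows "\<delta> \<cdot> (\<iota> D \<otimes> f) \<cdot> \<delta> = (\<iota> D \<otimes> ((\<iota> D \<otimes> f) \<cdot> \<delta>)) \<cdot> \<delta>"
proof -
  have "\<delta> \<cdot> (\<iota> D \<otimes> f) = (\<iota> D \<otimes> \<iota> D \<otimes> f) \<cdot> (\<delta> \<otimes> \<iota> D)"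
    using interchange [of "\<iota> D" \<delta> f "\<iota> \<K>"] interchange [of \<delta> "\<iota> (D \<boxtimes> D)" "\<iota> D" f]
      tensor_assoc [of "\<iota> D" "\<iota> D" f]
    by (simp add: tensor_ident del: tensor_assoc)
  then have "\<delta> \<cdot> (\<iota> D \<otimes> f) \<cdot> \<delta> = (\<iota> D \<otimes> \<iota> D \<otimes> f) \<cdot> (\<delta> \<otimes> \<iota> D) \<cdot> \<delta>"
    using compos_assoc' [of \<delta> "\<iota> D \<otimes> f" \<delta>] by simp
  then show ?thesis
    by (simp add: comult_coassoc interchange_compos)
qed

lemma convolution_absorb:
  assumes [simp]: "f \<in> Arr C" "Dom C f = D" "Cod C f = \<K>"
    "g \<in> Arr C" "Dom C g = D" "h \<in> Arr C" "Dom C h = D"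
    and "h \<cdot> (\<iota> D \<otimes> f) \<cdot> \<delta> = h"
  shows "(g \<otimes> h) \<cdot> \<delta> \<cdot> (\<iota> D \<otimes> f) \<cdot> \<delta> = (g \<otimes> h) \<cdot> \<delta>"
  using assms(8) by (simp add: comult_absorb interchange_compos)

lemma convolution_assoc:
  assumes A: "algebra_in C A \<eta> \<mu>"
    and f: "f \<in> hom C D A" and g: "g \<in> hom C D A" and h: "h \<in> hom C D A"
  shows "convolution C \<delta> \<mu> (convolution C \<delta> \<mu> f g) h =
    convolution C \<delta> \<mu> f (convolution C \<delta> \<mu> g h)"
proof -
  interpret A: algebra_in C A \<eta> \<mu> by fact
  note [simp] = A.algebra_Ob homD [OF A.mult_hom] homD [OF f] homD [OF g] homD [OF h]
  have "convolution C \<delta> \<mu> (convolution C \<delta> \<mu> f g) h =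
      \<mu> \<cdot> (\<mu> \<otimes> \<iota> A) \<cdot> (f \<otimes> g \<otimes> h) \<cdot> (\<delta> \<otimes> \<iota> D) \<cdot> \<delta>"
    using interchange_compos [of "(f \<otimes> g) \<cdot> \<delta>" \<mu> h "\<iota> A" \<delta>]
      interchange_compos [of \<delta> "f \<otimes> g" "\<iota> D" h \<delta>]
    by (simp add: convolution_def)
  also have "\<dots> = \<mu> \<cdot> (\<iota> A \<otimes> \<mu>) \<cdot> (f \<otimes> g \<otimes> h) \<cdot> (\<iota> D \<otimes> \<delta>) \<cdot> \<delta>"
    by (simp add: compos_cong_left [OF A.mult_assoc] comult_coassoc)
  also have "\<dots> = convolution C \<delta> \<mu> f (convolution C \<delta> \<mu> g h)"
    by (simp add: convolution_def interchange_compos)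
  finally show ?thesis .
qed

end

section \<open>Change of coalgebra\<close>

context strict_symmetric_monoidal_category
begin

text \<open>A comultiplicative morphism \<open>m\<close> may be pushed through \<open>spread\<close>; it need not preserve the
  counit, and for the multiplication of a weak Hopf algebra it does not in general.\<close>

lemma spread_compos:
  assumes D: "coalgebra_in C D \<epsilon> \<delta>" and E: "coalgebra_in C E \<epsilon>' \<delta>'"
    and [simp]: "A \<in> Ob C" "Z \<in> Arr C" "Dom C Z = E \<boxtimes> A" "f \<in> Arr C" "Dom C f = E"
    "m \<in> Arr C" "Dom C m = D" "Cod C m = E"
    and m: "\<delta>' \<cdot> m = (m \<otimes> m) \<cdot> \<delta>"
  shows "spread E \<delta>' A Z f \<cdot> (m \<otimes> \<iota> A) = spread D \<delta> A (Z \<cdot> (m \<otimes> \<iota> A)) (f \<cdot> m)"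
proof -
  interpret D: symmetric_coalgebra C D \<epsilon> \<delta>
    by (intro symmetric_coalgebra.intro D strict_symmetric_monoidal_category_axioms)
  interpret E: symmetric_coalgebra C E \<epsilon>' \<delta>'
    by (intro symmetric_coalgebra.intro E strict_symmetric_monoidal_category_axioms)
  have "(\<delta>' \<otimes> \<iota> A) \<cdot> (m \<otimes> \<iota> A) = (m \<otimes> m \<otimes> \<iota> A) \<cdot> (\<delta> \<otimes> \<iota> A)"
    using interchange [of \<delta> "m \<otimes> m" "\<iota> A" "\<iota> A"] by (simp add: interchange m)
  moreover have s: "(\<iota> E \<otimes> \<c> E A) \<cdot> (m \<otimes> m \<otimes> \<iota> A) = (m \<otimes> \<iota> A \<otimes> m) \<cdot> (\<iota> D \<otimes> \<c> D A)"
    using symm_nat [of m "\<iota> A" E A] by (simp add: interchange)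
  ultimately have "spread E \<delta>' A Z f \<cdot> (m \<otimes> \<iota> A) =
      (Z \<otimes> f) \<cdot> (m \<otimes> \<iota> A \<otimes> m) \<cdot> (\<iota> D \<otimes> \<c> D A) \<cdot> (\<delta> \<otimes> \<iota> A)"
    by (simp add: spread_def compos_cong_left [OF s])
  also have "\<dots> = spread D \<delta> A (Z \<cdot> (m \<otimes> \<iota> A)) (f \<cdot> m)"
    using interchange_compos [of "m \<otimes> \<iota> A" Z m f "(\<iota> D \<otimes> \<c> D A) \<cdot> (\<delta> \<otimes> \<iota> A)"]
    by (simp add: spread_def)
  finally show ?thesis .
qed

text \<open>Both sides map \<open>d \<otimes> h \<otimes> a\<close> to \<open>Z (d\<^sub>1, W (h\<^sub>1, a)) \<otimes> d\<^sub>2 \<otimes> h\<^sub>2\<close>.\<close>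

lemma spread_tensor_coalgebra:
  assumes D: "coalgebra_in C D \<epsilon> \<delta>" and E: "coalgebra_in C E \<epsilon>' \<delta>'"
    and [simp]: "A \<in> Ob C" "B \<in> Ob C" "W \<in> Arr C" "Dom C W = E \<boxtimes> A" "Cod C W = B"
    "Z \<in> Arr C" "Dom C Z = D \<boxtimes> B"
  shows "(spread D \<delta> B Z (\<iota> D) \<otimes> \<iota> E) \<cdot> (\<iota> D \<otimes> spread E \<delta>' A W (\<iota> E)) =
    spread (D \<boxtimes> E) (tensor_comult C D \<delta> E \<delta>') A (Z \<cdot> (\<iota> D \<otimes> W)) (\<iota> (D \<boxtimes> E))"
proof -
  interpret D: symmetric_coalgebra C D \<epsilon> \<delta>
    by (intro symmetric_coalgebra.intro D strict_symmetric_monoidal_category_axioms)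
  interpret E: symmetric_coalgebra C E \<epsilon>' \<delta>'
    by (intro symmetric_coalgebra.intro E strict_symmetric_monoidal_category_axioms)
  interpret DE: symmetric_coalgebra C "D \<boxtimes> E" "\<epsilon> \<otimes> \<epsilon>'" "tensor_comult C D \<delta> E \<delta>'"
    by (intro symmetric_coalgebra.intro tensor_coalgebra D E
        strict_symmetric_monoidal_category_axioms)
  \<comment> \<open>Move \<open>W\<close> to the left past \<open>\<delta>\<close> and the symmetry (\<open>s1\<close>, \<open>s2\<close>), then collect the
    symmetries into those of the tensor coalgebra (\<open>s3\<close>, \<open>s4\<close>).\<close>
  have s1: "(\<delta> \<otimes> \<iota> (B \<boxtimes> E)) \<cdot> (\<iota> D \<otimes> W \<otimes> \<iota> E) =
      (\<iota> (D \<boxtimes> D) \<otimes> W \<otimes> \<iota> E) \<cdot> (\<delta> \<otimes> \<iota> (E \<boxtimes> A \<boxtimes> E))"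
    using interchange [of "\<iota> D" \<delta> "W \<otimes> \<iota> E" "\<iota> (B \<boxtimes> E)"]
      interchange [of \<delta> "\<iota> (D \<boxtimes> D)" "\<iota> (E \<boxtimes> A \<boxtimes> E)" "W \<otimes> \<iota> E"] by simp
  have s2: "(\<iota> D \<otimes> \<c> D B \<otimes> \<iota> E) \<cdot> (\<iota> (D \<boxtimes> D) \<otimes> W \<otimes> \<iota> E) =
      (\<iota> D \<otimes> W \<otimes> \<iota> (D \<boxtimes> E)) \<cdot> (\<iota> D \<otimes> \<c> D (E \<boxtimes> A) \<otimes> \<iota> E)"
    using symm_nat [of "\<iota> D" W D B]
      interchange [of "\<iota> D \<otimes> W" "\<c> D B" "\<iota> E" "\<iota> E"]
      interchange [of "\<iota> D" "\<iota> D" "\<iota> D \<otimes> W \<otimes> \<iota> E" "\<c> D B \<otimes> \<iota> E"]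
      interchange [of "\<c> D (E \<boxtimes> A)" "W \<otimes> \<iota> D" "\<iota> E" "\<iota> E"]
      interchange [of "\<iota> D" "\<iota> D" "\<c> D (E \<boxtimes> A) \<otimes> \<iota> E" "(W \<otimes> \<iota> D) \<otimes> \<iota> E"]
    by (simp add: tensor_ident [symmetric])
  have s3: "(\<delta> \<otimes> \<iota> (E \<boxtimes> A \<boxtimes> E)) \<cdot> (\<iota> D \<otimes> \<iota> E \<otimes> \<c> E A) \<cdot> (\<iota> D \<otimes> \<delta>' \<otimes> \<iota> A) =
      (\<iota> (D \<boxtimes> D) \<otimes> \<iota> E \<otimes> \<c> E A) \<cdot> (\<delta> \<otimes> \<delta>' \<otimes> \<iota> A)"
    by (simp add: interchange)
  have s4: "(\<iota> D \<otimes> \<c> D (E \<boxtimes> A) \<otimes> \<iota> E) \<cdot> (\<iota> (D \<boxtimes> D) \<otimes> \<iota> E \<otimes> \<c> E A) =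
      (\<iota> (D \<boxtimes> E) \<otimes> \<c> (D \<boxtimes> E) A) \<cdot> (\<iota> D \<otimes> \<c> D E \<otimes> \<iota> E \<otimes> \<iota> A)"
  proof -
    have "(\<c> D E \<otimes> \<iota> (A \<boxtimes> E)) \<cdot> (\<iota> (D \<boxtimes> E) \<otimes> \<c> E A) =
        (\<iota> (E \<boxtimes> D) \<otimes> \<c> E A) \<cdot> (\<c> D E \<otimes> \<iota> (E \<boxtimes> A))"
      by (simp add: interchange)
    then have q: "(\<c> D E \<otimes> \<iota> A \<otimes> \<iota> E) \<cdot> (\<iota> D \<otimes> \<iota> E \<otimes> \<c> E A) =
        (\<iota> E \<otimes> \<iota> D \<otimes> \<c> E A) \<cdot> (\<c> D E \<otimes> \<iota> E \<otimes> \<iota> A)"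
      by (simp add: tensor_ident [symmetric])
    have "\<c> D (E \<boxtimes> A) \<otimes> \<iota> E = (\<iota> E \<otimes> \<c> D A \<otimes> \<iota> E) \<cdot> (\<c> D E \<otimes> \<iota> A \<otimes> \<iota> E)"
      using interchange [of "\<c> D E \<otimes> \<iota> A" "\<iota> E \<otimes> \<c> D A" "\<iota> E" "\<iota> E"]
      by (simp add: symm_hexagon)
    then have "(\<c> D (E \<boxtimes> A) \<otimes> \<iota> E) \<cdot> (\<iota> D \<otimes> \<iota> E \<otimes> \<c> E A) =
        (\<iota> E \<otimes> \<c> D A \<otimes> \<iota> E) \<cdot> (\<c> D E \<otimes> \<iota> A \<otimes> \<iota> E) \<cdot> (\<iota> D \<otimes> \<iota> E \<otimes> \<c> E A)"
      by simp
    also have "\<dots> = (\<iota> E \<otimes> \<c> D A \<otimes> \<iota> E) \<cdot> (\<iota> E \<otimes> \<iota> D \<otimes> \<c> E A) \<cdot> (\<c> D E \<otimes> \<iota> E \<otimes> \<iota> A)"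
      by (simp add: q)
    also have "\<dots> = (\<iota> E \<otimes> \<c> (D \<boxtimes> E) A) \<cdot> (\<c> D E \<otimes> \<iota> E \<otimes> \<iota> A)"
      by (simp add: symm_tensor_left interchange_compos)
    finally show ?thesis
      using interchange [of "\<iota> D" "\<iota> D" "\<iota> D \<otimes> \<iota> E \<otimes> \<c> E A" "\<c> D (E \<boxtimes> A) \<otimes> \<iota> E"]
        interchange [of "\<iota> D" "\<iota> D" "\<c> D E \<otimes> \<iota> E \<otimes> \<iota> A" "\<iota> E \<otimes> \<c> (D \<boxtimes> E) A"]
      by (simp add: tensor_ident [symmetric])
  qed
  have "spread D \<delta> B Z (\<iota> D) \<otimes> \<iota> E =
      (Z \<otimes> \<iota> D \<otimes> \<iota> E) \<cdot> (\<iota> D \<otimes> \<c> D B \<otimes> \<iota> E) \<cdot> (\<delta> \<otimes> \<iota> (B \<boxtimes> E))"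
    using interchange [of "(\<iota> D \<otimes> \<c> D B) \<cdot> (\<delta> \<otimes> \<iota> B)" "Z \<otimes> \<iota> D" "\<iota> E" "\<iota> E"]
      interchange [of "\<delta> \<otimes> \<iota> B" "\<iota> D \<otimes> \<c> D B" "\<iota> E" "\<iota> E"]
    by (simp add: spread_def tensor_ident [symmetric])
  moreover have "\<iota> D \<otimes> spread E \<delta>' A W (\<iota> E) =
      (\<iota> D \<otimes> W \<otimes> \<iota> E) \<cdot> (\<iota> D \<otimes> \<iota> E \<otimes> \<c> E A) \<cdot> (\<iota> D \<otimes> \<delta>' \<otimes> \<iota> A)"
    by (simp add: spread_def interchange)
  ultimately have "(spread D \<delta> B Z (\<iota> D) \<otimes> \<iota> E) \<cdot> (\<iota> D \<otimes> spread E \<delta>' A W (\<iota> E)) =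
      (Z \<otimes> \<iota> D \<otimes> \<iota> E) \<cdot> (\<iota> D \<otimes> \<c> D B \<otimes> \<iota> E) \<cdot> (\<delta> \<otimes> \<iota> (B \<boxtimes> E)) \<cdot>
      (\<iota> D \<otimes> W \<otimes> \<iota> E) \<cdot> (\<iota> D \<otimes> \<iota> E \<otimes> \<c> E A) \<cdot> (\<iota> D \<otimes> \<delta>' \<otimes> \<iota> A)"
    by simp
  also have "\<dots> = (Z \<otimes> \<iota> D \<otimes> \<iota> E) \<cdot> (\<iota> D \<otimes> W \<otimes> \<iota> (D \<boxtimes> E)) \<cdot>
      (\<iota> D \<otimes> \<c> D (E \<boxtimes> A) \<otimes> \<iota> E) \<cdot> (\<iota> (D \<boxtimes> D) \<otimes> \<iota> E \<otimes> \<c> E A) \<cdot> (\<delta> \<otimes> \<delta>' \<otimes> \<iota> A)"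
    by (simp add: compos_cong_left [OF s1] compos_cong_left [OF s2] s3)
  also have "\<dots> = (Z \<otimes> \<iota> D \<otimes> \<iota> E) \<cdot> (\<iota> D \<otimes> W \<otimes> \<iota> (D \<boxtimes> E)) \<cdot>
      (\<iota> (D \<boxtimes> E) \<otimes> \<c> (D \<boxtimes> E) A) \<cdot> (\<iota> D \<otimes> \<c> D E \<otimes> \<iota> E \<otimes> \<iota> A) \<cdot> (\<delta> \<otimes> \<delta>' \<otimes> \<iota> A)"
    by (simp add: compos_cong_left [OF s4])
  also have "\<dots> = spread (D \<boxtimes> E) (tensor_comult C D \<delta> E \<delta>') A (Z \<cdot> (\<iota> D \<otimes> W)) (\<iota> (D \<boxtimes> E))"
  proof -
    have "(Z \<otimes> \<iota> (D \<boxtimes> E)) \<cdot> ((\<iota> D \<otimes> W) \<otimes> \<iota> (D \<boxtimes> E)) = (Z \<cdot> (\<iota> D \<otimes> W)) \<otimes> \<iota> (D \<boxtimes> E)"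
      by (subst interchange) simp_all
    then have q: "(Z \<otimes> \<iota> D \<otimes> \<iota> E) \<cdot> (\<iota> D \<otimes> W \<otimes> \<iota> (D \<boxtimes> E)) \<cdot> k =
        ((Z \<cdot> (\<iota> D \<otimes> W)) \<otimes> \<iota> (D \<boxtimes> E)) \<cdot> k"
      if "k \<in> Arr C" "Cod C k = D \<boxtimes> E \<boxtimes> A \<boxtimes> D \<boxtimes> E" for k
      using that compos_assoc' [of k "\<iota> D \<otimes> W \<otimes> \<iota> (D \<boxtimes> E)" "Z \<otimes> \<iota> (D \<boxtimes> E)"]
      by (simp add: tensor_ident)
    have "(\<iota> D \<otimes> \<c> D E \<otimes> \<iota> E \<otimes> \<iota> A) \<cdot> (\<delta> \<otimes> \<delta>' \<otimes> \<iota> A) = tensor_comult C D \<delta> E \<delta>' \<otimes> \<iota> A"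
      using interchange [of "\<delta> \<otimes> \<delta>'" "\<iota> D \<otimes> \<c> D E \<otimes> \<iota> E" "\<iota> A" "\<iota> A"]
      by (simp add: tensor_comult_def)
    then show ?thesis
      by (simp add: q spread_def)
  qed
  finally show ?thesis .
qed

end

section \<open>The two twisted conditions\<close>

theorem theorem2p15:
  fixes C :: "('o, 'm, 'z) sm_cat_scheme" (structure)
    and H A :: 'o
    and \<eta>H \<mu>H \<epsilon>H \<delta>H \<eta>A \<mu>A \<phi>A \<sigma> :: 'm
  assumes "strict_symmetric_monoidal_category_with_equalizers C"
    and "weak_hopf_algebra C H \<eta>H \<mu>H \<epsilon>H \<delta>H"
    and "cocommutative C H \<delta>H"
    and "weak_module_algebra C H \<eta>H \<mu>H \<epsilon>H \<delta>H A \<eta>A \<mu>A \<phi>A"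
    and "\<sigma> \<in> Reg2 C H \<mu>H \<delta>H A \<eta>A \<mu>A \<phi>A"
  shows "twisted_morphism C H \<mu>H \<delta>H A \<mu>A \<phi>A \<sigma> \<longleftrightarrow>
    twisted_quadruple C A \<mu>A H (psi_HA C H \<delta>H A \<phi>A) (sigma_HA C H \<mu>H \<delta>H \<sigma>)"
proof -
  interpret weak_module_algebra C H \<eta>H \<mu>H \<epsilon>H \<delta>H A \<eta>A \<mu>A \<phi>A by fact
  have H: "coalgebra_in C H \<epsilon>H \<delta>H" ..
  interpret H: symmetric_coalgebra C H \<epsilon>H \<delta>H
    by (intro symmetric_coalgebra.intro H strict_symmetric_monoidal_category_axioms)
  let ?D = "H \<boxtimes> H" and ?\<Delta> = "tensor_comult C H \<delta>H H \<delta>H"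
  interpret D: symmetric_coalgebra C ?D "\<epsilon>H \<otimes> \<epsilon>H" ?\<Delta>
    by (intro symmetric_coalgebra.intro tensor_coalgebra H strict_symmetric_monoidal_category_axioms)
  obtain \<sigma>' where sigma: "\<sigma> \<in> hom C ?D A" and sigma': "\<sigma>' \<in> hom C ?D A"
    and conv: "convolution C ?\<Delta> \<mu>A (convolution C ?\<Delta> \<mu>A \<sigma> \<sigma>') \<sigma> = \<sigma>"
    and conv': "convolution C ?\<Delta> \<mu>A \<sigma>' \<sigma> = u2 C \<mu>H \<eta>A \<phi>A"
    using assms(5) by (auto simp: Reg2_def Let_def)
  note [simp] = A.algebra_Ob homD [OF mult_hom] homD [OF A.mult_hom] homD [OF A.unit_hom]
    homD [OF action_hom] homD [OF sigma]
  let ?f = "\<epsilon>H \<cdot> \<mu>H" and ?\<tau> = "\<phi>A \<cdot> (\<iota> H \<otimes> \<phi>A)"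
  \<comment> \<open>\<open>e\<close> is what remains of \<open>spread Z \<mu>H\<close> after applying the counit of \<open>H\<close>.\<close>
  define e where "e = (\<iota> ?D \<otimes> ?f) \<cdot> ?\<Delta>"
  have e_type [simp]: "e \<in> Arr C" "Dom C e = ?D" "Cod C e = ?D"
    by (simp_all add: e_def)
  have mult_absorb: "\<mu>H \<cdot> e = \<mu>H"
  proof -
    have "\<mu>H \<cdot> e = (\<mu>H \<otimes> (\<epsilon>H \<cdot> \<mu>H)) \<cdot> ?\<Delta>"
      using interchange_compos [of "\<iota> ?D" \<mu>H ?f "\<iota> \<K>" ?\<Delta>] by (simp add: e_def)
    also have "\<dots> = (\<iota> H \<otimes> \<epsilon>H) \<cdot> (\<mu>H \<otimes> \<mu>H) \<cdot> ?\<Delta>"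
      by (simp add: interchange_compos)
    also have "\<dots> = (\<iota> H \<otimes> \<epsilon>H) \<cdot> \<delta>H \<cdot> \<mu>H"
      by (simp add: comult_mult)
    also have "\<dots> = ((\<iota> H \<otimes> \<epsilon>H) \<cdot> \<delta>H) \<cdot> \<mu>H"
      by simp
    also have "\<dots> = \<mu>H"
      by (simp only: counit_right) simp
    finally show ?thesis .
  qed
  have sigma_u2: "\<sigma> = \<mu>A \<cdot> (\<sigma> \<otimes> u2 C \<mu>H \<eta>A \<phi>A) \<cdot> ?\<Delta>"
    using conv conv' D.convolution_assoc [OF A.algebra_in_axioms sigma sigma' sigma]
    by (simp add: convolution_def)
  have u2_eq: "u2 C \<mu>H \<eta>A \<phi>A = \<phi>A \<cdot> (\<iota> H \<otimes> \<eta>A) \<cdot> \<mu>H"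
    using interchange [of \<mu>H "\<iota> H" "\<iota> \<K>" \<eta>A] by (simp add: u2_def)
  have u2_type [simp]: "u2 C \<mu>H \<eta>A \<phi>A \<in> Arr C" "Dom C (u2 C \<mu>H \<eta>A \<phi>A) = ?D"
    "Cod C (u2 C \<mu>H \<eta>A \<phi>A) = A"
    by (simp_all add: u2_def)
  have u2_absorb: "u2 C \<mu>H \<eta>A \<phi>A \<cdot> e = u2 C \<mu>H \<eta>A \<phi>A"
    by (simp add: u2_eq mult_absorb)
  have convolution_absorb: "(g \<otimes> h) \<cdot> ?\<Delta> \<cdot> e = (g \<otimes> h) \<cdot> ?\<Delta>"
    if "g \<in> Arr C" "Dom C g = ?D" "h \<in> Arr C" "Dom C h = ?D" "h \<cdot> e = h" for g h
    using that D.convolution_absorb [of ?f g h] by (simp add: e_def)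
  have sigma_absorb: "\<sigma> \<cdot> e = \<sigma>"
  proof -
    have "\<sigma> \<cdot> e = (\<mu>A \<cdot> (\<sigma> \<otimes> u2 C \<mu>H \<eta>A \<phi>A) \<cdot> ?\<Delta>) \<cdot> e"
      using sigma_u2 by (rule arg_cong)
    also have "\<dots> = \<mu>A \<cdot> (\<sigma> \<otimes> u2 C \<mu>H \<eta>A \<phi>A) \<cdot> ?\<Delta>"
      by (simp add: convolution_absorb u2_absorb)
    finally show ?thesis
      using sigma_u2 by simp
  qed

  \<comment> \<open>\<open>X\<close> and \<open>Y\<close> are the two sides of the twisted condition for \<open>\<sigma>\<close>.\<close>
  define X where "X = \<mu>A \<cdot> spread ?D ?\<Delta> A ?\<tau> \<sigma>"
  define Y where "Y = \<mu>A \<cdot> (\<sigma> \<otimes> (\<phi>A \<cdot> (\<mu>H \<otimes> \<iota> A))) \<cdot> (?\<Delta> \<otimes> \<iota> A)"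
  have XY_type [simp]: "X \<in> Arr C" "Dom C X = ?D \<boxtimes> A" "Cod C X = A"
    "Y \<in> Arr C" "Dom C Y = ?D \<boxtimes> A" "Cod C Y = A"
    by (simp_all add: X_def Y_def)
  have sigma_HA_type [simp]: "sigma_HA C H \<mu>H \<delta>H \<sigma> \<in> Arr C"
    "Dom C (sigma_HA C H \<mu>H \<delta>H \<sigma>) = ?D" "Cod C (sigma_HA C H \<mu>H \<delta>H \<sigma>) = A \<boxtimes> H"
    by (simp_all add: sigma_HA_def)
  have X_eq: "X = \<mu>A \<cdot> (?\<tau> \<otimes> \<iota> A) \<cdot> (\<iota> H \<otimes> \<iota> H \<otimes> \<c> A A) \<cdot>
      (((\<iota> H \<otimes> \<iota> H \<otimes> \<sigma>) \<cdot> ?\<Delta>) \<otimes> \<iota> A)"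
  proof -
    have "(\<iota> ?D \<otimes> \<c> A A) \<cdot> (\<iota> ?D \<otimes> \<sigma> \<otimes> \<iota> A) = (\<iota> (?D \<boxtimes> A) \<otimes> \<sigma>) \<cdot> (\<iota> ?D \<otimes> \<c> ?D A)"
      using symm_nat [of \<sigma> "\<iota> A" A A] interchange [of "\<iota> ?D" "\<iota> ?D" "\<sigma> \<otimes> \<iota> A" "\<c> A A"]
        interchange [of "\<iota> ?D" "\<iota> ?D" "\<c> ?D A" "\<iota> A \<otimes> \<sigma>"] tensor_assoc [of "\<iota> ?D" "\<iota> A" \<sigma>]
      by (simp add: tensor_ident del: tensor_assoc)
    then have s: "(\<iota> H \<otimes> \<iota> H \<otimes> \<c> A A) \<cdot> (\<iota> H \<otimes> \<iota> H \<otimes> \<sigma> \<otimes> \<iota> A) =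
        (\<iota> (?D \<boxtimes> A) \<otimes> \<sigma>) \<cdot> (\<iota> ?D \<otimes> \<c> ?D A)"
      by (simp add: tensor_ident [symmetric])
    have "((\<iota> H \<otimes> \<iota> H \<otimes> \<sigma>) \<cdot> ?\<Delta>) \<otimes> \<iota> A = (\<iota> H \<otimes> \<iota> H \<otimes> \<sigma> \<otimes> \<iota> A) \<cdot> (?\<Delta> \<otimes> \<iota> A)"
      using interchange [of ?\<Delta> "\<iota> H \<otimes> \<iota> H \<otimes> \<sigma>" "\<iota> A" "\<iota> A"] by simp
    then have "\<mu>A \<cdot> (?\<tau> \<otimes> \<iota> A) \<cdot> (\<iota> H \<otimes> \<iota> H \<otimes> \<c> A A) \<cdot> (((\<iota> H \<otimes> \<iota> H \<otimes> \<sigma>) \<cdot> ?\<Delta>) \<otimes> \<iota> A) =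
        \<mu>A \<cdot> (?\<tau> \<otimes> \<iota> A) \<cdot> (\<iota> (?D \<boxtimes> A) \<otimes> \<sigma>) \<cdot> (\<iota> ?D \<otimes> \<c> ?D A) \<cdot> (?\<Delta> \<otimes> \<iota> A)"
      by (simp add: compos_cong_left [OF s])
    then show ?thesis
      by (simp add: X_def spread_def interchange_compos)
  qed
  have sigma_HA_tensor: "sigma_HA C H \<mu>H \<delta>H \<sigma> \<otimes> \<iota> A = (\<sigma> \<otimes> \<mu>H \<otimes> \<iota> A) \<cdot> (?\<Delta> \<otimes> \<iota> A)"
    using interchange [of ?\<Delta> "\<sigma> \<otimes> \<mu>H" "\<iota> A" "\<iota> A"] by (simp add: sigma_HA_def)
  have Y_eq: "Y = \<mu>A \<cdot> (\<iota> A \<otimes> \<phi>A) \<cdot> (sigma_HA C H \<mu>H \<delta>H \<sigma> \<otimes> \<iota> A)"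
    by (simp add: Y_def sigma_HA_tensor interchange_compos)
  have X_absorb: "X \<cdot> (e \<otimes> \<iota> A) = X"
  proof -
    have "((\<iota> H \<otimes> \<iota> H \<otimes> \<sigma>) \<cdot> ?\<Delta>) \<cdot> e = (\<iota> H \<otimes> \<iota> H \<otimes> \<sigma>) \<cdot> ?\<Delta>"
      using convolution_absorb [of "\<iota> ?D" \<sigma>] sigma_absorb by (simp add: tensor_ident [symmetric])
    then have "(((\<iota> H \<otimes> \<iota> H \<otimes> \<sigma>) \<cdot> ?\<Delta>) \<otimes> \<iota> A) \<cdot> (e \<otimes> \<iota> A) =
        ((\<iota> H \<otimes> \<iota> H \<otimes> \<sigma>) \<cdot> ?\<Delta>) \<otimes> \<iota> A"
      by (subst interchange) simp_all
    then show ?thesis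
      by (simp add: X_eq)
  qed
  have Y_absorb: "Y \<cdot> (e \<otimes> \<iota> A) = Y"
  proof -
    have "sigma_HA C H \<mu>H \<delta>H \<sigma> \<cdot> e = sigma_HA C H \<mu>H \<delta>H \<sigma>"
      using convolution_absorb [of \<sigma> \<mu>H] mult_absorb by (simp add: sigma_HA_def)
    then show ?thesis
      by (simp add: Y_eq interchange)
  qed

  have psi: "psi_HA C H \<delta>H A \<phi>A = spread H \<delta>H A \<phi>A (\<iota> H)"
    by (simp add: psi_HA_def spread_def)
  have lhs: "(\<mu>A \<otimes> \<iota> H) \<cdot> (\<iota> A \<otimes> psi_HA C H \<delta>H A \<phi>A) \<cdot> (sigma_HA C H \<mu>H \<delta>H \<sigma> \<otimes> \<iota> A) =
      spread ?D ?\<Delta> A Y \<mu>H"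
  proof -
    have "(\<iota> A \<otimes> psi_HA C H \<delta>H A \<phi>A) \<cdot> (sigma_HA C H \<mu>H \<delta>H \<sigma> \<otimes> \<iota> A) =
        (\<sigma> \<otimes> (psi_HA C H \<delta>H A \<phi>A \<cdot> (\<mu>H \<otimes> \<iota> A))) \<cdot> (?\<Delta> \<otimes> \<iota> A)"
      by (simp add: psi sigma_HA_tensor interchange_compos)
    also have "psi_HA C H \<delta>H A \<phi>A \<cdot> (\<mu>H \<otimes> \<iota> A) = spread ?D ?\<Delta> A (\<phi>A \<cdot> (\<mu>H \<otimes> \<iota> A)) \<mu>H"
      using spread_compos [OF D.coalgebra_in_axioms H, of A \<phi>A "\<iota> H" \<mu>H] by (simp add: psi comult_mult)
    finally show ?thesis
      by (simp add: D.tensor_spread D.compos_spread Y_def)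
  qed
  have rhs: "(\<mu>A \<otimes> \<iota> H) \<cdot> (\<iota> A \<otimes> sigma_HA C H \<mu>H \<delta>H \<sigma>) \<cdot>
      (psi_HA C H \<delta>H A \<phi>A \<otimes> \<iota> H) \<cdot> (\<iota> H \<otimes> psi_HA C H \<delta>H A \<phi>A) = spread ?D ?\<Delta> A X \<mu>H"
  proof -
    have "(psi_HA C H \<delta>H A \<phi>A \<otimes> \<iota> H) \<cdot> (\<iota> H \<otimes> psi_HA C H \<delta>H A \<phi>A) = spread ?D ?\<Delta> A ?\<tau> (\<iota> ?D)"
      using spread_tensor_coalgebra [OF H H, of A A \<phi>A \<phi>A] by (simp add: psi)
    then have "(\<iota> A \<otimes> sigma_HA C H \<mu>H \<delta>H \<sigma>) \<cdot>
        (psi_HA C H \<delta>H A \<phi>A \<otimes> \<iota> H) \<cdot> (\<iota> H \<otimes> psi_HA C H \<delta>H A \<phi>A) =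
        spread ?D ?\<Delta> A ?\<tau> ((\<sigma> \<otimes> \<mu>H) \<cdot> ?\<Delta>)"
      by (simp add: D.compos_spread sigma_HA_def)
    also have "\<dots> = spread ?D ?\<Delta> A (spread ?D ?\<Delta> A ?\<tau> \<sigma>) \<mu>H"
      by (simp add: D.spread_spread)
    finally show ?thesis
      by (simp add: D.compos_spread X_def)
  qed
  have apply_counit: "(\<iota> A \<otimes> \<epsilon>H) \<cdot> spread ?D ?\<Delta> A Z \<mu>H = Z \<cdot> (e \<otimes> \<iota> A)"
    if "Z \<in> Arr C" "Dom C Z = ?D \<boxtimes> A" "Cod C Z = A" for Z
    using that by (simp add: D.compos_spread D.spread_counit e_def)
  have "twisted_morphism C H \<mu>H \<delta>H A \<mu>A \<phi>A \<sigma> \<longleftrightarrow> X = Y"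
    by (simp only: twisted_morphism_def X_eq Y_eq)
  also have "\<dots> \<longleftrightarrow> spread ?D ?\<Delta> A Y \<mu>H = spread ?D ?\<Delta> A X \<mu>H"
    using apply_counit [of X] apply_counit [of Y] X_absorb Y_absorb by auto
  also have "\<dots> \<longleftrightarrow> twisted_quadruple C A \<mu>A H (psi_HA C H \<delta>H A \<phi>A) (sigma_HA C H \<mu>H \<delta>H \<sigma>)"
    by (simp only: twisted_quadruple_def lhs rhs)
  finally show ?thesis .
qed

end
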